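(* Let $G=(V,E)$ be a finite directed graph with kernel $K$, nowhere-zero stationary distribution $\pi$, and symmetric Laplacian $\Delta$. Let $\zeta_1,\dots,\zeta_n$ be real numbers, $f_1,\dots,f_n:V\to\mathbb R$, and $Q_1,\dots,Q_n\subseteq V$ pairwise disjoint, such that for each $i$: $f_i|_{Q_i}\neq 0$, and either ($\Delta f_i\le \zeta_i f_i$ pointwise and $Q_i$ is a nonnegative bipolar part of $f_i$) or ($\Delta f_i\ge\zeta_i f_i$ pointwise and $Q_i$ is a nonpositive bipolar part of $f_i$). Then $$2\,\overline\zeta_n\ \ge\ \iota_n(G,K)^2,\qquad\text{where } \overline\zeta_n=\frac1n\sum_{i=1}^n\zeta_i .$$
   Context: $G=(V,E)$ is a finite directed graph (loops allowed). A kernel on $G$ is a row-stochastic matrix $K:V\times V\to[0,1]$ with $K(u,v)>0$ for every $uv\in E$ and $K(u,v)=0$ whenever $u\ne v$, $uv\notin E$; $\pi:V\to(0,\infty)$ is a probability vector with $\pi K=\pi$. $\phi(u,v)=K(u,v)\pi(u)$; $\pi(Q)=\sum_{u\in Q}\pi(u)$; $\vec\partial(Q)=\sum_{u\in Q,v\notin Q}\phi(u,v)$; $\iota_n(G,K)=\min\frac1n\sum_{i=1}^n\vec\partial(Q_i)/\pi(Q_i)$ over all families of $n$ nonempty pairwise disjoint subsets of $V$. $\Delta=\mathrm{id}-\overline K$ with $\overline K(u,v)=\frac12(K(u,v)+K(v,u)\pi(v)/\pi(u))$. For $Q\subseteq V$, $f|_Q$ equals $f$ on $Q$ and $0$ off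 $Q$. $(Q,V\setminus Q)$ is a bipolar cut-set for $f$ if $f(u)f(v)\le0$ for every edge $uv\in E$ with exactly one endpoint in $Q$ (in either direction). $Q$ is a nonnegative (resp. nonpositive) bipolar part of $f$ if $f|_Q\ge0$ (resp. $f|_Q\le 0$) and $(Q,V\setminus Q)$ is a bipolar cut-set for $f$. *)

theory Defs
  imports Complex_Main "HOL-Library.FuncSet" "HOL-Library.Disjoint_Sets" "Graph_Theory.Pair_Digraph"
begin

text \<open>
  Graphs \<open>G = (V, E)\<close> with \<open>E \<subseteq> V \<times> V\<close> are of type \<open>'a pair_pre_digraph\<close>, finite ones being
  characterised by the locale predicate \<^const>\<open>pair_fin_digraph\<close>, which allows loops.
  Functions on \<open>V\<close> are total functions on \<open>'a\<close> whose values off \<open>pverts G\<close> are never used.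
\<close>

text \<open>The support condition says nothing about \<open>K u u\<close> when there is no loop at \<open>u\<close>.\<close>

definition row_stochastic_kernel :: "'a pair_pre_digraph \<Rightarrow> ('a \<Rightarrow> 'a \<Rightarrow> real) \<Rightarrow> bool" where
  "row_stochastic_kernel G K \<longleftrightarrow>
     (\<forall>u\<in>pverts G. \<forall>v\<in>pverts G. 0 \<le> K u v \<and> K u v \<le> 1) \<and>
     (\<forall>u\<in>pverts G. (\<Sum>v\<in>pverts G. K u v) = 1) \<and>
     (\<forall>(u, v)\<in>parcs G. 0 < K u v) \<and>
     (\<forall>u\<in>pverts G. \<forall>v\<in>pverts G. u \<noteq> v \<and> (u, v) \<notin> parcs G \<longrightarrow> K u v = 0)"

definition pos_stationary ::
    "'a pair_pre_digraph \<Rightarrow> ('a \<Rightarrow> 'a \<Rightarrow> real) \<Rightarrow> ('a \<Rightarrow> real) \<Rightarrow> bool" where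
  "pos_stationary G K \<pi> \<longleftrightarrow>
     (\<forall>u\<in>pverts G. 0 < \<pi> u) \<and>
     (\<Sum>u\<in>pverts G. \<pi> u) = 1 \<and>
     (\<forall>v\<in>pverts G. (\<Sum>u\<in>pverts G. \<pi> u * K u v) = \<pi> v)"

definition flow :: "('a \<Rightarrow> 'a \<Rightarrow> real) \<Rightarrow> ('a \<Rightarrow> real) \<Rightarrow> 'a \<Rightarrow> 'a \<Rightarrow> real" where
  "flow K \<pi> u v = K u v * \<pi> u"

definition out_flow ::
    "'a pair_pre_digraph \<Rightarrow> ('a \<Rightarrow> 'a \<Rightarrow> real) \<Rightarrow> ('a \<Rightarrow> real) \<Rightarrow> 'a set \<Rightarrow> real" where
  "out_flow G K \<pi> Q = (\<Sum>u\<in>Q. \<Sum>v\<in>pverts G - Q. flow K \<pi> u v)"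

definition disjoint_families :: "'a pair_pre_digraph \<Rightarrow> nat \<Rightarrow> (nat \<Rightarrow> 'a set) set" where
  "disjoint_families G n =
     {Q \<in> {1..n} \<rightarrow>\<^sub>E Pow (pverts G). (\<forall>i\<in>{1..n}. Q i \<noteq> {}) \<and> disjoint_family_on Q {1..n}}"

text \<open>
  For finite \<open>G\<close> the minimum is over a finite set; it is nonempty, so that \<^const>\<open>Min\<close> is
  meaningful, exactly when \<open>n \<le> card (pverts G)\<close>. The stationary distribution is an explicit
  argument because \<open>K\<close> need not determine it.
\<close>

definition isoperimetric_const ::
    "'a pair_pre_digraph \<Rightarrow> ('a \<Rightarrow> 'a \<Rightarrow> real) \<Rightarrow> ('a \<Rightarrow> real) \<Rightarrow> nat \<Rightarrow> real" where
  "isoperimetric_const G K \<pi> n =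
     Min ((\<lambda>Q. 1 / real n * (\<Sum>i=1..n. out_flow G K \<pi> (Q i) / (\<Sum>u\<in>Q i. \<pi> u)))
            ` disjoint_families G n)"

definition sym_kernel ::
    "('a \<Rightarrow> 'a \<Rightarrow> real) \<Rightarrow> ('a \<Rightarrow> real) \<Rightarrow> 'a \<Rightarrow> 'a \<Rightarrow> real" where
  "sym_kernel K \<pi> u v = 1 / 2 * (K u v + K v u * \<pi> v / \<pi> u)"

definition laplacian ::
    "'a pair_pre_digraph \<Rightarrow> ('a \<Rightarrow> 'a \<Rightarrow> real) \<Rightarrow> ('a \<Rightarrow> real) \<Rightarrow> ('a \<Rightarrow> real) \<Rightarrow> 'a \<Rightarrow> real" where
  "laplacian G K \<pi> f u = f u - (\<Sum>v\<in>pverts G. sym_kernel K \<pi> u v * f v)"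

definition restr :: "('a \<Rightarrow> real) \<Rightarrow> 'a set \<Rightarrow> 'a \<Rightarrow> real" where
  "restr f Q u = (if u \<in> Q then f u else 0)"

definition bipolar_cut_set :: "'a pair_pre_digraph \<Rightarrow> ('a \<Rightarrow> real) \<Rightarrow> 'a set \<Rightarrow> bool" where
  "bipolar_cut_set G f Q \<longleftrightarrow>
     (\<forall>(u, v)\<in>parcs G. (u \<in> Q) \<noteq> (v \<in> Q) \<longrightarrow> f u * f v \<le> 0)"

definition nonneg_bipolar_part :: "'a pair_pre_digraph \<Rightarrow> ('a \<Rightarrow> real) \<Rightarrow> 'a set \<Rightarrow> bool" where
  "nonneg_bipolar_part G f Q \<longleftrightarrow> (\<forall>u\<in>pverts G. restr f Q u \<ge> 0) \<and> bipolar_cut_set G f Q"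

definition nonpos_bipolar_part :: "'a pair_pre_digraph \<Rightarrow> ('a \<Rightarrow> real) \<Rightarrow> 'a set \<Rightarrow> bool" where
  "nonpos_bipolar_part G f Q \<longleftrightarrow> (\<forall>u\<in>pverts G. restr f Q u \<le> 0) \<and> bipolar_cut_set G f Q"

end

theory Submission
  imports Defs "HOL-Analysis.Convex"
begin

text \<open>
  Let \<open>g = \<bar>f i\<bar>\<close> on \<open>Q i\<close> and \<open>g = 0\<close> off \<open>Q i\<close>. Discarding the part of \<open>f i\<close> outside \<open>Q i\<close> can only
  lower the energy, because the discarded terms have the right sign on a bipolar cut-set; so the
  Rayleigh quotient of \<open>g\<close> is at most \<open>\<zeta> i\<close>. Cheeger's argument applied to \<open>g\<^sup>2\<close> (co-area inequality
  plus Cauchy-Schwarz) then gives a nonempty \<open>S i \<subseteq> Q i\<close> whose isoperimetric ratio \<open>h i\<close> satisfies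
  \<open>(h i)\<^sup>2 \<le> 2 * \<zeta> i\<close>. The \<open>S i\<close> are disjoint, so the mean of the \<open>h i\<close> bounds the isoperimetric
  constant, and the square of a mean is at most the mean of the squares.
\<close>

section \<open>Cheeger's inequality for abstract weights\<close>

text \<open>Instead of integrating over level sets, the induction peels off one layer at a time.
  Subtracting the least positive value \<open>m\<close> of \<open>F\<close> on its support
  \<open>S\<close> lowers the left side by \<open>h * m * sum p S\<close> and the right side by
  \<open>m\<close> times the boundary weight of \<open>S\<close>; the hypothesis compares these two
  amounts.\<close>

lemma coarea_le:
  fixes w :: "'a \<Rightarrow> 'a \<Rightarrow> real" and p F :: "'a \<Rightarrow> real"
  assumes "finite V"
    and "\<And>u. u \<in> V \<Longrightarrow> F u \<ge> 0"
    and "\<And>S. S \<subseteq> {u\<in>V. F u > 0} \<Longrightarrow> S \<noteq> {} \<Longrightarrow> h * sum p S \<le> (\<Sum>u\<in>S. \<Sum>v\<in>V - S. w u v)"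
  shows "h * (\<Sum>u\<in>V. p u * F u) \<le> (\<Sum>u\<in>V. \<Sum>v\<in>V. w u v * max (F u - F v) 0)"
  using assms(2,3)
proof (induction "card {u\<in>V. F u > 0}" arbitrary: F rule: less_induct)
  case less
  define S where "S = {u\<in>V. F u > 0}"
  have finS: "finite S" and SV: "S \<subseteq> V" using assms(1) by (auto simp: S_def)
  have F0: "F u = 0" if "u \<in> V - S" for u
    using that less.prems(1)[of u] by (auto simp: S_def)
  show ?case
  proof (cases "S = {}")
    case True
    then have "F u = 0" if "u \<in> V" for u using F0 that by auto
    then show ?thesis by simp
  next
    case False
    define m where "m = Min (F ` S)"
    have mle: "m \<le> F u" if "u \<in> S" for u using that finS by (simp add: m_def)
    have "m \<in> F ` S" unfolding m_def using False finS by (intro Min_in) auto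
    then obtain u0 where u0: "u0 \<in> S" "m = F u0" by auto
    then have mpos: "m > 0" by (auto simp: S_def)
    define F' where "F' u = (if u \<in> S then F u - m else F u)" for u
    have nonneg: "F' u \<ge> 0" if "u \<in> V" for u
      using that mle less.prems(1) by (auto simp: F'_def)
    \<comment> \<open>The minimum is attained at \<open>u0\<close>, so \<open>u0\<close> leaves the
      support and the induction measure drops.\<close>
    have sub: "{u\<in>V. F' u > 0} \<subseteq> S - {u0}"
      using F0 u0 by (auto simp: F'_def S_def split: if_splits)
    have "card {u\<in>V. F' u > 0} < card S"
      using sub finS u0 by (metis DiffD2 Diff_subset insertI1 psubsetI psubset_card_mono subsetD subset_trans)
    then have IH: "h * (\<Sum>u\<in>V. p u * F' u) \<le> (\<Sum>u\<in>V. \<Sum>v\<in>V. w u v * max (F' u - F' v) 0)"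
      using sub nonneg by (intro less.hyps) (auto simp: S_def intro!: less.prems(2))
    have "(\<Sum>u\<in>V. p u * F u) = (\<Sum>u\<in>V. p u * F' u + (if u \<in> S then m * p u else 0))"
      by (intro sum.cong) (auto simp: F'_def algebra_simps)
    also have "\<dots> = (\<Sum>u\<in>V. p u * F' u) + m * sum p S"
      using assms(1) SV by (simp add: sum.distrib sum.If_cases Int_absorb1 sum_distrib_left)
    finally have eq1: "(\<Sum>u\<in>V. p u * F u) = (\<Sum>u\<in>V. p u * F' u) + m * sum p S" .
    \<comment> \<open>Only pairs leaving \<open>S\<close> are affected, each by exactly
      \<open>m\<close>: differences within \<open>S\<close> are unchanged, and for \<open>u\<close>
      outside \<open>S\<close> both positive parts are 0.\<close>
    have *: "w u v * max (F u - F v) 0 = w u v * max (F' u - F' v) 0 +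
        (if u \<in> S then if v \<in> V - S then m * w u v else 0 else 0)" if "u \<in> V" "v \<in> V" for u v
      using that F0[of u] F0[of v] mle[of u] mle[of v] mpos
      by (cases "u \<in> S"; cases "v \<in> S") (auto simp: F'_def max_def algebra_simps)
    have "(\<Sum>u\<in>V. \<Sum>v\<in>V. if u \<in> S then if v \<in> V - S then m * w u v else 0 else 0)
        = (\<Sum>u\<in>V. if u \<in> S then (\<Sum>v\<in>V. if v \<in> V - S then m * w u v else 0) else 0)"
      by (intro sum.cong) auto
    also have "\<dots> = (\<Sum>u\<in>S. \<Sum>v\<in>V - S. m * w u v)"
    proof -
      have "V \<inter> S = S" "V \<inter> (V - S) = V - S" using SV by auto
      then show ?thesis by (simp only: sum.inter_restrict[OF assms(1), symmetric])
    qed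
    finally have "(\<Sum>u\<in>V. \<Sum>v\<in>V. w u v * max (F u - F v) 0)
        = (\<Sum>u\<in>V. \<Sum>v\<in>V. w u v * max (F' u - F' v) 0) + m * (\<Sum>u\<in>S. \<Sum>v\<in>V - S. w u v)"
      by (simp add: * sum.distrib sum_distrib_left cong: sum.cong)
    moreover have "m * (h * sum p S) \<le> m * (\<Sum>u\<in>S. \<Sum>v\<in>V - S. w u v)"
      using less.prems(2)[of S] False mpos by (simp add: S_def)
    ultimately show ?thesis using IH eq1 by (simp add: algebra_simps)
  qed
qed

text \<open>Equal marginals do the work of symmetry, which a flow lacks in general: a term depending
  on one endpoint alone has the same total for either endpoint.\<close>

lemma sum_weighted_marginals:
  fixes w :: "'a \<Rightarrow> 'a \<Rightarrow> real"
  assumes "\<And>u. u \<in> V \<Longrightarrow> (\<Sum>v\<in>V. w u v) = p u"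
    and "\<And>v. v \<in> V \<Longrightarrow> (\<Sum>u\<in>V. w u v) = p v"
  shows "(\<Sum>u\<in>V. \<Sum>v\<in>V. w u v * F u) = (\<Sum>u\<in>V. p u * F u)"
    and "(\<Sum>u\<in>V. \<Sum>v\<in>V. w u v * F v) = (\<Sum>u\<in>V. p u * F u)"
proof -
  show "(\<Sum>u\<in>V. \<Sum>v\<in>V. w u v * F u) = (\<Sum>u\<in>V. p u * F u)"
    by (simp add: assms(1) flip: sum_distrib_right)
  show "(\<Sum>u\<in>V. \<Sum>v\<in>V. w u v * F v) = (\<Sum>u\<in>V. p u * F u)"
    by (subst sum.swap) (simp add: assms(2) flip: sum_distrib_right)
qed

text \<open>The chain is \<open>4 * (r S)\<^sup>2 * N\<^sup>2 \<le> A\<^sup>2 \<le> 4 * (N - C) * (N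
  + C) \<le> 4 * (z * N) * (2 * N)\<close>: co-area for the square of \<open>g\<close>, then
  Cauchy-Schwarz, then \<open>ray\<close> together with \<open>C \<le> N\<close>.\<close>

lemma cheeger_subset:
  fixes w :: "'a \<Rightarrow> 'a \<Rightarrow> real" and p g :: "'a \<Rightarrow> real"
  assumes fin: "finite V"
    and w: "\<And>u v. u \<in> V \<Longrightarrow> v \<in> V \<Longrightarrow> w u v \<ge> 0"
    and row: "\<And>u. u \<in> V \<Longrightarrow> (\<Sum>v\<in>V. w u v) = p u"
    and col: "\<And>v. v \<in> V \<Longrightarrow> (\<Sum>u\<in>V. w u v) = p v"
    and p: "\<And>u. u \<in> V \<Longrightarrow> p u > 0"
    and g: "\<And>u. u \<in> V \<Longrightarrow> g u \<ge> 0" and nz: "\<exists>u\<in>V. g u \<noteq> 0"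
    and ray: "(\<Sum>u\<in>V. p u * (g u)\<^sup>2) - (\<Sum>u\<in>V. \<Sum>v\<in>V. w u v * (g u * g v))
               \<le> z * (\<Sum>u\<in>V. p u * (g u)\<^sup>2)"
  obtains S where "S \<subseteq> {u\<in>V. g u > 0}" "S \<noteq> {}"
    "((\<Sum>u\<in>S. \<Sum>v\<in>V - S. w u v) / sum p S)\<^sup>2 \<le> 2 * z"
proof -
  define \<S> where "\<S> = {S. S \<subseteq> {u\<in>V. g u > 0} \<and> S \<noteq> {}}"
  define r where "r S = (\<Sum>u\<in>S. \<Sum>v\<in>V - S. w u v) / sum p S" for S
  define N where "N = (\<Sum>u\<in>V. p u * (g u)\<^sup>2)"
  define C where "C = (\<Sum>u\<in>V. \<Sum>v\<in>V. w u v * (g u * g v))"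
  define A where "A = (\<Sum>u\<in>V. \<Sum>v\<in>V. w u v * \<bar>(g u)\<^sup>2 - (g v)\<^sup>2\<bar>)"
  obtain u1 where u1: "u1 \<in> V" "g u1 > 0" using nz g by force
  have "finite \<S>" unfolding \<S>_def using fin by simp
  moreover have "{u1} \<in> \<S>" using u1 by (auto simp: \<S>_def)
  \<comment> \<open>A minimiser over all nonempty subsets of the support makes
    \<open>h = r S\<close> admissible in \<open>coarea_le\<close>.\<close>
  ultimately obtain S where S: "S \<in> \<S>" and Smin: "\<And>T. T \<in> \<S> \<Longrightarrow> r S \<le> r T"
    by (metis arg_min_if_finite(1) arg_min_least empty_iff)
  have ppos: "sum p T > 0" if "T \<in> \<S>" for T
    using that p fin by (intro sum_pos) (auto simp: \<S>_def intro: finite_subset)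
  have "r S * sum p T \<le> (\<Sum>u\<in>T. \<Sum>v\<in>V - T. w u v)" if "T \<in> \<S>" for T
    using Smin[OF that] ppos[OF that] by (simp add: r_def[of T] field_simps)
  then have "r S * N \<le> (\<Sum>u\<in>V. \<Sum>v\<in>V. w u v * max ((g u)\<^sup>2 - (g v)\<^sup>2) 0)"
    unfolding N_def using fin g
    by (intro coarea_le) (auto simp: \<S>_def subset_iff order_less_le)
  \<comment> \<open>The positive part of \<open>x\<close> is half of
    \<open>\<bar>x\<bar> + x\<close>; the linear halves cancel in the sum because the marginals
    agree.\<close>
  also have "\<dots> = (\<Sum>u\<in>V. \<Sum>v\<in>V. 1/2 * (w u v * \<bar>(g u)\<^sup>2 - (g v)\<^sup>2\<bar>)
      + 1/2 * (w u v * (g u)\<^sup>2) - 1/2 * (w u v * (g v)\<^sup>2))"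
    by (intro sum.cong refl) (auto simp: max_def abs_if field_simps)
  also have "\<dots> = 1/2 * A"
    unfolding A_def
    by (simp add: sum.distrib sum_subtractf sum_weighted_marginals[OF row col]
        flip: sum_distrib_left sum_divide_distrib)
  finally have rA: "2 * (r S * N) \<le> A" by simp
  have "A\<^sup>2 = (\<Sum>(u,v)\<in>V\<times>V. (sqrt (w u v) * \<bar>g u - g v\<bar>) * (sqrt (w u v) * (g u + g v)))\<^sup>2"
    unfolding A_def sum.cartesian_product
  proof (intro arg_cong[where f = "\<lambda>x. x\<^sup>2"] sum.cong refl, safe)
    fix u v assume uv: "u \<in> V" "v \<in> V"
    have "\<bar>(g u)\<^sup>2 - (g v)\<^sup>2\<bar> = \<bar>g u - g v\<bar> * (g u + g v)"
      using g[OF uv(1)] g[OF uv(2)] by (simp add: square_diff_square_factored power2_eq_square abs_mult)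
    then show "w u v * \<bar>(g u)\<^sup>2 - (g v)\<^sup>2\<bar> = sqrt (w u v) * \<bar>g u - g v\<bar> * (sqrt (w u v) * (g u + g v))"
      using w[OF uv] by simp
  qed
  also have "\<dots> \<le> (\<Sum>(u,v)\<in>V\<times>V. (sqrt (w u v) * \<bar>g u - g v\<bar>)\<^sup>2) * (\<Sum>(u,v)\<in>V\<times>V. (sqrt (w u v) * (g u + g v))\<^sup>2)"
    unfolding case_prod_unfold by (rule Cauchy_Schwarz_ineq_sum)
  also have "(\<Sum>(u,v)\<in>V\<times>V. (sqrt (w u v) * \<bar>g u - g v\<bar>)\<^sup>2) = (\<Sum>u\<in>V. \<Sum>v\<in>V. w u v * (g u - g v)\<^sup>2)"
    unfolding sum.cartesian_product using w by (intro sum.cong) (auto simp: power_mult_distrib)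
  also have "(\<Sum>(u,v)\<in>V\<times>V. (sqrt (w u v) * (g u + g v))\<^sup>2) = (\<Sum>u\<in>V. \<Sum>v\<in>V. w u v * (g u + g v)\<^sup>2)"
    unfolding sum.cartesian_product using w by (intro sum.cong) (auto simp: power_mult_distrib)
  finally have CS: "A\<^sup>2 \<le> (\<Sum>u\<in>V. \<Sum>v\<in>V. w u v * (g u - g v)\<^sup>2) * (\<Sum>u\<in>V. \<Sum>v\<in>V. w u v * (g u + g v)\<^sup>2)" .
  have minus: "(\<Sum>u\<in>V. \<Sum>v\<in>V. w u v * (g u - g v)\<^sup>2) = 2 * N - 2 * C"
  proof -
    have "(\<Sum>u\<in>V. \<Sum>v\<in>V. w u v * (g u - g v)\<^sup>2)
        = (\<Sum>u\<in>V. \<Sum>v\<in>V. w u v * (g u)\<^sup>2 + w u v * (g v)\<^sup>2 - 2 * (w u v * (g u * g v)))"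
      by (intro sum.cong) (auto simp: power2_eq_square algebra_simps)
    then show ?thesis unfolding N_def C_def
      by (simp add: sum.distrib sum_subtractf sum_weighted_marginals[OF row col] flip: sum_distrib_left)
  qed
  have plus: "(\<Sum>u\<in>V. \<Sum>v\<in>V. w u v * (g u + g v)\<^sup>2) = 2 * N + 2 * C"
  proof -
    have "(\<Sum>u\<in>V. \<Sum>v\<in>V. w u v * (g u + g v)\<^sup>2)
        = (\<Sum>u\<in>V. \<Sum>v\<in>V. w u v * (g u)\<^sup>2 + w u v * (g v)\<^sup>2 + 2 * (w u v * (g u * g v)))"
      by (intro sum.cong) (auto simp: power2_eq_square algebra_simps)
    then show ?thesis unfolding N_def C_def
      by (simp add: sum.distrib sum_weighted_marginals[OF row col] flip: sum_distrib_left)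
  qed
  \<comment> \<open>This gives \<open>N + C \<le> 2 * N\<close> and, with \<open>ray\<close>, also
    \<open>0 \<le> z * N\<close>, so that the two estimates may be multiplied.\<close>
  have "0 \<le> 2 * N - 2 * C" unfolding minus[symmetric] using w by (intro sum_nonneg mult_nonneg_nonneg) auto
  moreover have "0 \<le> 2 * N + 2 * C" unfolding plus[symmetric] using w by (intro sum_nonneg mult_nonneg_nonneg) auto
  ultimately have "(N - C) * (N + C) \<le> (z * N) * (2 * N)"
    using ray unfolding N_def[symmetric] C_def[symmetric] by (intro mult_mono) auto
  moreover have "N > 0"
    unfolding N_def using fin u1 p by (intro sum_pos2[of V u1]) (auto simp: less_imp_le)
  moreover have "r S \<ge> 0"
    unfolding r_def using S w p
    by (intro divide_nonneg_nonneg sum_nonneg) (auto simp: \<S>_def subset_iff less_imp_le)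
  then have "(2 * (r S * N))\<^sup>2 \<le> A\<^sup>2" using rA \<open>N > 0\<close> by (intro power_mono) auto
  moreover have "(2 * (r S * N))\<^sup>2 = 4 * ((r S)\<^sup>2 * N\<^sup>2)" "(z * N) * (2 * N) = (2 * z) * N\<^sup>2"
    "(2 * N - 2 * C) * (2 * N + 2 * C) = 4 * ((N - C) * (N + C))"
    by (simp_all add: power2_eq_square algebra_simps)
  ultimately have "(r S)\<^sup>2 * N\<^sup>2 \<le> (2 * z) * N\<^sup>2" using CS unfolding minus plus by linarith
  then have "(r S)\<^sup>2 \<le> 2 * z" using \<open>N > 0\<close> by simp
  then show ?thesis using that[of S] S by (simp add: \<S>_def r_def)
qed

section \<open>Bipolar parts and the kernel Laplacian\<close>

lemma laplacian_uminus: "laplacian G K \<pi> (\<lambda>u. - f u) u = - laplacian G K \<pi> f u"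
  by (simp add: laplacian_def sum_negf)

text \<open>With \<open>laplacian_uminus\<close> this reduces the nonpositive case to the
  nonnegative one; the cut-set condition is even in \<open>f\<close>.\<close>

lemma nonneg_bipolar_part_uminus:
  "nonneg_bipolar_part G (\<lambda>u. - f u) Q \<longleftrightarrow> nonpos_bipolar_part G f Q"
  by (simp add: nonneg_bipolar_part_def nonpos_bipolar_part_def bipolar_cut_set_def restr_def
      if_distrib[of uminus] if_distrib[of "\<lambda>x. 0 \<le> x"] if_distrib[of "\<lambda>x. x \<le> 0"])

context
  fixes G :: "'a pair_pre_digraph" and K :: "'a \<Rightarrow> 'a \<Rightarrow> real" and \<pi> :: "'a \<Rightarrow> real"
  assumes fin: "finite (pverts G)"
    and kernel: "row_stochastic_kernel G K"
    and stat: "pos_stationary G K \<pi>"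
begin

lemma stationary_pos: "u \<in> pverts G \<Longrightarrow> \<pi> u > 0"
  using stat by (simp add: pos_stationary_def)

lemma flow_nonneg: "u \<in> pverts G \<Longrightarrow> v \<in> pverts G \<Longrightarrow> flow K \<pi> u v \<ge> 0"
  using kernel stationary_pos by (simp add: flow_def row_stochastic_kernel_def less_imp_le)

lemma sum_flow_out: "u \<in> pverts G \<Longrightarrow> (\<Sum>v\<in>pverts G. flow K \<pi> u v) = \<pi> u"
  using kernel by (simp add: flow_def row_stochastic_kernel_def flip: sum_distrib_right)

text \<open>Stationarity gives this marginal, stochasticity the one in \<open>sum_flow_out\<close>;
  together they are the \<open>row\<close> and \<open>col\<close> assumptions of
  \<open>cheeger_subset\<close>.\<close>

lemma sum_flow_in: "v \<in> pverts G \<Longrightarrow> (\<Sum>u\<in>pverts G. flow K \<pi> u v) = \<pi> v"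
  using stat by (simp add: flow_def pos_stationary_def mult.commute)

text \<open>The left side is the pairing of \<open>g\<close> with its own Laplacian, weighted by
  \<pi>. Replacing that Laplacian by the one of \<open>f\<close> can only increase it, by
  \<open>cut\<close>; then \<open>lap\<close> is multiplied by \<open>g u \<ge> 0\<close> and
  summed.\<close>

lemma energy_restr_le:
  assumes lap: "\<And>u. u \<in> pverts G \<Longrightarrow> laplacian G K \<pi> f u \<le> z * f u"
    and part: "nonneg_bipolar_part G f Q"
  defines "g \<equiv> restr f Q"
  shows "(\<Sum>u\<in>pverts G. \<pi> u * (g u)\<^sup>2)
           - (\<Sum>u\<in>pverts G. \<Sum>v\<in>pverts G. flow K \<pi> u v * (g u * g v))
         \<le> z * (\<Sum>u\<in>pverts G. \<pi> u * (g u)\<^sup>2)"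
proof -
  let ?V = "pverts G"
  have g0: "g u \<ge> 0" if "u \<in> ?V" for u
    using part that by (simp add: nonneg_bipolar_part_def g_def)
  have K0: "K u v \<ge> 0" if "u \<in> ?V" "v \<in> ?V" for u v
    using kernel that by (simp add: row_stochastic_kernel_def)
  have sym_eq: "\<pi> u * sym_kernel K \<pi> u v = 1/2 * (flow K \<pi> u v + flow K \<pi> v u)" if "u \<in> ?V" for u v
    using stationary_pos[OF that] by (simp add: sym_kernel_def flow_def field_simps)
  have cut: "sym_kernel K \<pi> u v * (g u * f v) \<le> sym_kernel K \<pi> u v * (g u * g v)"
    if "u \<in> ?V" "v \<in> ?V" for u v
  proof (cases "u \<in> Q \<and> v \<notin> Q")
    case True
    \<comment> \<open>Off the edges the kernel is known to vanish only between distinct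
      vertices.\<close>
    then have uv: "u \<noteq> v" by auto
    have s0: "sym_kernel K \<pi> u v \<ge> 0"
      using that K0 stationary_pos by (simp add: sym_kernel_def less_imp_le)
    show ?thesis
    proof (cases "(u, v) \<in> parcs G \<or> (v, u) \<in> parcs G")
      case True
      then have "f u * f v \<le> 0"
        using part \<open>u \<in> Q \<and> v \<notin> Q\<close>
        by (fastforce simp: nonneg_bipolar_part_def bipolar_cut_set_def mult.commute)
      then show ?thesis using s0 \<open>u \<in> Q \<and> v \<notin> Q\<close>
        by (simp add: g_def restr_def mult_nonneg_nonpos)
    next
      case False
      then have "K u v = 0" "K v u = 0"
        using kernel that uv by (auto simp: row_stochastic_kernel_def)
      then show ?thesis by (simp add: sym_kernel_def)
    qed
  qed (auto simp: g_def restr_def)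
  \<comment> \<open>As \<open>g u * g v\<close> is symmetric, the flow may be averaged with its
    reversal, which produces \<open>sym_kernel\<close>.\<close>
  have "(\<Sum>u\<in>?V. \<Sum>v\<in>?V. flow K \<pi> u v * (g u * g v))
      = (\<Sum>u\<in>?V. \<Sum>v\<in>?V. 1/2 * (flow K \<pi> u v * (g u * g v)) + 1/2 * (flow K \<pi> v u * (g v * g u)))"
    unfolding sum.distrib
    by (subst (3) sum.swap) (simp flip: sum_distrib_left sum_divide_distrib)
  also have "\<dots> = (\<Sum>u\<in>?V. \<Sum>v\<in>?V. \<pi> u * (sym_kernel K \<pi> u v * (g u * g v)))"
  proof (intro sum.cong refl)
    fix u v assume "u \<in> ?V" "v \<in> ?V"
    have "\<pi> u * (sym_kernel K \<pi> u v * (g u * g v)) = (\<pi> u * sym_kernel K \<pi> u v) * (g u * g v)"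
      by (rule mult.assoc[symmetric])
    also have "\<dots> = 1/2 * (flow K \<pi> u v * (g u * g v)) + 1/2 * (flow K \<pi> v u * (g v * g u))"
      unfolding sym_eq[OF \<open>u \<in> ?V\<close>] by (simp add: field_simps)
    finally show "1/2 * (flow K \<pi> u v * (g u * g v)) + 1/2 * (flow K \<pi> v u * (g v * g u))
        = \<pi> u * (sym_kernel K \<pi> u v * (g u * g v))" by (rule sym)
  qed
  finally have "(\<Sum>u\<in>?V. \<pi> u * (g u)\<^sup>2) - (\<Sum>u\<in>?V. \<Sum>v\<in>?V. flow K \<pi> u v * (g u * g v))
      = (\<Sum>u\<in>?V. \<pi> u * ((g u)\<^sup>2 - (\<Sum>v\<in>?V. sym_kernel K \<pi> u v * (g u * g v))))"
    by (simp add: sum_subtractf right_diff_distrib sum_distrib_left)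
  also have "\<dots> \<le> (\<Sum>u\<in>?V. \<pi> u * (z * (g u)\<^sup>2))"
  proof (intro sum_mono mult_left_mono)
    fix u assume u: "u \<in> ?V"
    have "(g u)\<^sup>2 - (\<Sum>v\<in>?V. sym_kernel K \<pi> u v * (g u * g v))
        \<le> (g u)\<^sup>2 - (\<Sum>v\<in>?V. sym_kernel K \<pi> u v * (g u * f v))"
      using cut u by (intro diff_left_mono sum_mono) auto
    \<comment> \<open>Each \<open>g u\<close> is \<open>f u\<close> or 0, so
      \<open>(g u)\<^sup>2 = g u * f u\<close>.\<close>
    also have "\<dots> = g u * laplacian G K \<pi> f u"
      by (simp add: g_def restr_def laplacian_def power2_eq_square right_diff_distrib
          sum_distrib_left mult.left_commute)
    also have "\<dots> \<le> g u * (z * f u)"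
      using lap[OF u] g0[OF u] by (rule mult_left_mono)
    also have "\<dots> = z * (g u)\<^sup>2" by (simp add: g_def restr_def power2_eq_square)
    finally show "(g u)\<^sup>2 - (\<Sum>v\<in>?V. sym_kernel K \<pi> u v * (g u * g v)) \<le> z * (g u)\<^sup>2" .
  qed (use stationary_pos in \<open>simp add: less_imp_le\<close>)
  finally show ?thesis by (simp add: sum_distrib_left mult.left_commute)
qed

text \<open>The support of the restriction lies in \<open>Q\<close>, hence so does the set found by
  \<open>cheeger_subset\<close>; this is how disjointness will pass from the parts to these
  sets.\<close>

lemma bipolar_part_cheeger:
  assumes lap: "\<And>u. u \<in> pverts G \<Longrightarrow> laplacian G K \<pi> f u \<le> z * f u"
    and part: "nonneg_bipolar_part G f Q"
    and nz: "\<exists>u\<in>pverts G. restr f Q u \<noteq> 0"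
  shows "\<exists>S. S \<subseteq> Q \<inter> pverts G \<and> S \<noteq> {} \<and> (out_flow G K \<pi> S / (\<Sum>u\<in>S. \<pi> u))\<^sup>2 \<le> 2 * z"
proof -
  have nonneg: "restr f Q u \<ge> 0" if "u \<in> pverts G" for u
    using part that by (simp add: nonneg_bipolar_part_def)
  show ?thesis
  proof (rule cheeger_subset[of "pverts G" "flow K \<pi>" \<pi> "restr f Q" z])
    fix S assume S: "S \<subseteq> {u\<in>pverts G. restr f Q u > 0}" "S \<noteq> {}"
      "((\<Sum>u\<in>S. \<Sum>v\<in>pverts G - S. flow K \<pi> u v) / sum \<pi> S)\<^sup>2 \<le> 2 * z"
    from S(1) have "S \<subseteq> Q \<inter> pverts G" by (auto simp: restr_def split: if_splits)
    with S(2,3) show ?thesis unfolding out_flow_def by blast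
  qed (use fin flow_nonneg sum_flow_out sum_flow_in stationary_pos nonneg nz
        energy_restr_le[OF lap part] in simp_all)
qed

text \<open>The family \<open>S\<close> shows that the minimum is over a nonempty set, which the
  lower bound needs too. That bound will allow squaring.\<close>

lemma isoperimetric_const_bounds:
  assumes "\<And>i. i \<in> {1..n} \<Longrightarrow> S i \<subseteq> pverts G" "\<And>i. i \<in> {1..n} \<Longrightarrow> S i \<noteq> {}"
    and "disjoint_family_on S {1..n}"
  shows "0 \<le> isoperimetric_const G K \<pi> n"
    and "isoperimetric_const G K \<pi> n
           \<le> 1 / real n * (\<Sum>i=1..n. out_flow G K \<pi> (S i) / (\<Sum>u\<in>S i. \<pi> u))"
proof -
  let ?R = "\<lambda>Q. 1 / real n * (\<Sum>i=1..n. out_flow G K \<pi> (Q i) / (\<Sum>u\<in>Q i. \<pi> u))"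
  let ?D = "disjoint_families G n"
  have "finite ({1..n} \<rightarrow>\<^sub>E Pow (pverts G))" using fin by (intro finite_PiE) auto
  then have finD: "finite (?R ` ?D)" by (simp add: disjoint_families_def)
  \<comment> \<open>Families are extensional functions, so \<open>S\<close> must be made
    \<open>undefined\<close> off the index set; its ratios there do not enter the mean.\<close>
  have "restrict S {1..n} \<in> ?D"
    using assms by (auto simp: disjoint_families_def disjoint_family_on_def)
  then have mem: "?R (restrict S {1..n}) \<in> ?R ` ?D" by (rule imageI)
  have "?R Q \<ge> 0" if "Q \<in> ?D" for Q
    unfolding out_flow_def using that flow_nonneg stationary_pos
    by (intro mult_nonneg_nonneg sum_nonneg divide_nonneg_nonneg)
      (auto simp: disjoint_families_def subset_iff less_imp_le dest!: PiE_mem)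
  then show "0 \<le> isoperimetric_const G K \<pi> n"
    unfolding isoperimetric_const_def using finD mem by (subst Min_ge_iff) auto
  have "?R (restrict S {1..n}) = ?R S" by simp
  then show "isoperimetric_const G K \<pi> n \<le> ?R S"
    unfolding isoperimetric_const_def using Min_le[OF finD mem] by simp
qed

end

section \<open>Averaging over the family of parts\<close>

theorem theorem4:
  fixes G :: "'a pair_pre_digraph"
    and K :: "'a \<Rightarrow> 'a \<Rightarrow> real"
    and \<pi> :: "'a \<Rightarrow> real"
    and n :: nat
    and \<zeta> :: "nat \<Rightarrow> real"
    and f :: "nat \<Rightarrow> 'a \<Rightarrow> real"
    and Q :: "nat \<Rightarrow> 'a set"
  assumes "pair_fin_digraph G"
    and "row_stochastic_kernel G K"
    and "pos_stationary G K \<pi>"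
    and "n \<ge> 1"
    and "\<And>i. i \<in> {1..n} \<Longrightarrow> Q i \<subseteq> pverts G"
    and "disjoint_family_on Q {1..n}"
    and "\<And>i. i \<in> {1..n} \<Longrightarrow> \<exists>u\<in>pverts G. restr (f i) (Q i) u \<noteq> 0"
    and "\<And>i. i \<in> {1..n} \<Longrightarrow>
           ((\<forall>u\<in>pverts G. laplacian G K \<pi> (f i) u \<le> \<zeta> i * f i u) \<and>
              nonneg_bipolar_part G (f i) (Q i)) \<or>
           ((\<forall>u\<in>pverts G. laplacian G K \<pi> (f i) u \<ge> \<zeta> i * f i u) \<and>
              nonpos_bipolar_part G (f i) (Q i))"
  shows "2 * (1 / real n * (\<Sum>i=1..n. \<zeta> i)) \<ge> (isoperimetric_const G K \<pi> n)\<^sup>2"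
proof -
  interpret pair_fin_digraph G by fact
  note fin = pair_finite_verts
  have "\<exists>S. S \<subseteq> Q i \<inter> pverts G \<and> S \<noteq> {} \<and> (out_flow G K \<pi> S / (\<Sum>u\<in>S. \<pi> u))\<^sup>2 \<le> 2 * \<zeta> i"
    if i: "i \<in> {1..n}" for i
    using assms(8)[OF i]
  proof (elim disjE conjE)
    assume "\<forall>u\<in>pverts G. laplacian G K \<pi> (f i) u \<le> \<zeta> i * f i u" "nonneg_bipolar_part G (f i) (Q i)"
    then show ?thesis
      by (intro bipolar_part_cheeger[OF fin assms(2,3) _ _ assms(7)[OF i]]) auto
  next
    assume "\<forall>u\<in>pverts G. laplacian G K \<pi> (f i) u \<ge> \<zeta> i * f i u" "nonpos_bipolar_part G (f i) (Q i)"
    then show ?thesis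
      using assms(7)[OF i]
      by (intro bipolar_part_cheeger[OF fin assms(2,3), where f = "\<lambda>u. - f i u"])
        (auto simp: laplacian_uminus nonneg_bipolar_part_uminus restr_def split: if_splits)
  qed
  then have "\<exists>S. \<forall>i\<in>{1..n}. S i \<subseteq> Q i \<inter> pverts G \<and> S i \<noteq> {}
      \<and> (out_flow G K \<pi> (S i) / (\<Sum>u\<in>S i. \<pi> u))\<^sup>2 \<le> 2 * \<zeta> i"
    by (intro bchoice ballI)
  then obtain S where S: "\<And>i. i \<in> {1..n} \<Longrightarrow> S i \<subseteq> Q i \<inter> pverts G"
      "\<And>i. i \<in> {1..n} \<Longrightarrow> S i \<noteq> {}"
      "\<And>i. i \<in> {1..n} \<Longrightarrow> (out_flow G K \<pi> (S i) / (\<Sum>u\<in>S i. \<pi> u))\<^sup>2 \<le> 2 * \<zeta> i"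
    by blast
  define h where "h i = out_flow G K \<pi> (S i) / (\<Sum>u\<in>S i. \<pi> u)" for i
  have "disjoint_family_on S {1..n}"
    using assms(6) S(1) unfolding disjoint_family_on_def by blast
  then have "0 \<le> isoperimetric_const G K \<pi> n" "isoperimetric_const G K \<pi> n \<le> 1 / real n * (\<Sum>i=1..n. h i)"
    using isoperimetric_const_bounds[OF fin assms(2,3), of n S] S unfolding h_def by auto
  then have "(isoperimetric_const G K \<pi> n)\<^sup>2 \<le> (1 / real n * (\<Sum>i=1..n. h i))\<^sup>2"
    by (intro power_mono)
  \<comment> \<open>The square of a sum of \<open>n\<close> terms is at most \<open>n\<close> times
    the sum of squares; this \<open>n\<close> cancels one of the two factors
    \<open>1 / real n\<close>.\<close>
  also have "\<dots> \<le> (1 / real n)\<^sup>2 * ((\<Sum>i=1..n. (h i)\<^sup>2) * real n)"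
    unfolding power_mult_distrib using sum_squared_le_sum_of_squares[of h "{1..n}"]
    by (intro mult_left_mono) auto
  also have "\<dots> = 1 / real n * (\<Sum>i=1..n. (h i)\<^sup>2)"
    by (simp add: power2_eq_square)
  also have "\<dots> \<le> 1 / real n * (\<Sum>i=1..n. 2 * \<zeta> i)"
    using S(3) by (intro mult_left_mono sum_mono) (auto simp: h_def)
  finally show ?thesis by (simp flip: sum_distrib_left)
qed

end
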